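(* Let $N\ge1$ and consider the adaptive dynamics $\dot{\mathbf p}=\left.\frac{\partial A(\mathbf p,\mathbf q)}{\partial\mathbf p}\right|_{\mathbf q=\mathbf p}$ on $(0,1)^{2^{2N}}$ of an alternating memory-$N$ donation game. If $t\mapsto(p_{CC\ldots C}(t),\ldots,p_{DD\ldots D}(t))$ is a trajectory of these dynamics (entries listed in lexicographic order of their indices), then so is $t\mapsto(1-p_{DD\ldots D}(-t),\ldots,1-p_{CC\ldots C}(-t))$, where the entries of the strategy at time $-t$ are listed in reverse lexicographic order.
   Context: Words $i_1\ldots i_{2N}$ over $\{C,D\}$ are ordered lexicographically with $C$ before $D$. Strategies are vectors $\mathbf p=(p_{i_1\ldots i_{2N}})$, $\mathbf q=(q_{j_1\ldots j_{2N}})$ in $(0,1)^{2^{2N}}$ indexed by such words. The transition matrix $\mathbf M_N(\mathbf p,\mathbf q)$ is the $2^{2N}\times2^{2N}$ row-stochastic matrix whose row indexed by $i_1\ldots i_{2N}$ has only these nonzero entries: column $i_3\ldots i_{2N}CC$: $p_{i_1\ldots i_{2N}}\,q_{i_2\ldots i_{2N}C}$; column $i_3\ldots i_{2N}CD$: $p_{i_1\ldots i_{2N}}\,(1-q_{i_2\ldots i_{2N}C})$; column $i_3\ldots i_{2N}DC$: $(1-p_{i_1\ldots i_{2N}})\,q_{i_2\ldots i_{2N}D}$; column $i_3\ldots i_{2N}DD$: $(1-p_{i_1\ldots i_{2N}})\,(1-q_{i_2\ldots i_{2N}D})$. For $\mathbf p,\mathbf q$ in the open cube it has a unique invariant distribution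 $\nu_N(\mathbf p,\mathbf q)$: the probability vector with $\nu_N^T\mathbf M_N=\nu_N^T$. The donation game has real parameters $a,b,c,d$ with $c>a$ and $c-a<b-d$: a player choosing $C$ receives $a$ and gives the opponent $b$; a player choosing $D$ receives $c$ and gives the opponent $d$. The one-round payoffs of the first player after outcomes $CC,CD,DC,DD$ (own move first) are $R=a+b$, $S=a+d$, $T=c+b$, $P=c+d$. The payoff vector $\mathbf f_N\in\mathbb R^{2^{2N}}$ has entry at $i_1\ldots i_{2N}$ equal to the average over $k=1,\ldots,N$ of the one-round payoff ($R,S,T$ or $P$) of the outcome $i_{2k-1}i_{2k}$. The payoff function is $A(\mathbf p,\mathbf q)=\langle\nu_N(\mathbf p,\mathbf q),\mathbf f_N\rangle$. A trajectory is a solution of the ordinary differential equation on some time interval $I$; the transformed curve is then considered on $-I=\{-t:t\in I\}$. *)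

theory Defs
  imports "HOL-Analysis.Analysis" "HOL-Library.List_Lexorder"
begin

datatype action = C | D

instantiation action :: linorder
begin

definition less_eq_action :: "action \<Rightarrow> action \<Rightarrow> bool"
  where "x \<le> y \<longleftrightarrow> x = C \<or> y = D"

definition less_action :: "action \<Rightarrow> action \<Rightarrow> bool"
  where "x < y \<longleftrightarrow> x = C \<and> y = D"

instance
proof
  fix x y z :: action
  show "(x < y) = (x \<le> y \<and> \<not> y \<le> x)" "x \<le> x" "x \<le> y \<or> y \<le> x"
    by (cases x; cases y; simp add: less_eq_action_def less_action_def)+
  show "x \<le> y \<Longrightarrow> y \<le> z \<Longrightarrow> x \<le> z"
    by (cases x; cases y; cases z; simp add: less_eq_action_def)
  show "x \<le> y \<Longrightarrow> y \<le> x \<Longrightarrow> x = y"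
    by (cases x; cases y; simp add: less_eq_action_def)
qed

end

instance action :: finite
proof
  have "(UNIV :: action set) = {C, D}"
    using action.exhaust by auto
  then show "finite (UNIV :: action set)"
    by (metis finite.emptyI finite_insert)
qed

definition words :: "nat \<Rightarrow> action list set"
  where "words N = {w. length w = 2 * N}"

lemma finite_words [simp]: "finite (words N)"
  using finite_lists_length_eq[of "UNIV :: action set" "2 * N"] by (simp add: words_def)

text \<open>
  A vector with \<open>2 ^ (2 * N)\<close> entries is a function on words of which only the values on
  \<^term>\<open>words N\<close> matter. The order on words is the lexicographic one of
  \<^theory>\<open>HOL-Library.List_Lexorder\<close>.
\<close>

type_synonym wvec = "action list \<Rightarrow> real"

definition lex_words :: "nat \<Rightarrow> action list list"
  where "lex_words N = sorted_list_of_set (words N)"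

definition entries :: "nat \<Rightarrow> wvec \<Rightarrow> real list"
  where "entries N p = map p (lex_words N)"

definition of_entries :: "nat \<Rightarrow> real list \<Rightarrow> wvec"
  where "of_entries N xs = (\<lambda>w. the (map_of (zip (lex_words N) xs) w))"

definition open_cube :: "nat \<Rightarrow> wvec set"
  where "open_cube N = {p. \<forall>w\<in>words N. 0 < p w \<and> p w < 1}"

text \<open>For \<open>w\<close> of length \<open>2 * N\<close>, \<^term>\<open>tl w\<close> is \<open>i\<^sub>2 \<dots> i\<^sub>2\<^sub>N\<close> and
  \<^term>\<open>drop 2 w\<close> is \<open>i\<^sub>3 \<dots> i\<^sub>2\<^sub>N\<close>.\<close>

definition trans_matrix :: "wvec \<Rightarrow> wvec \<Rightarrow> action list \<Rightarrow> action list \<Rightarrow> real"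
  where "trans_matrix p q w v =
    (if v = drop 2 w @ [C, C] then p w * q (tl w @ [C])
     else if v = drop 2 w @ [C, D] then p w * (1 - q (tl w @ [C]))
     else if v = drop 2 w @ [D, C] then (1 - p w) * q (tl w @ [D])
     else if v = drop 2 w @ [D, D] then (1 - p w) * (1 - q (tl w @ [D]))
     else 0)"

text \<open>The last conjunct fixes the irrelevant values, so that there is only one such function.\<close>

definition invariant_distribution :: "nat \<Rightarrow> wvec \<Rightarrow> wvec \<Rightarrow> wvec \<Rightarrow> bool"
  where "invariant_distribution N p q \<nu> \<longleftrightarrow>
    (\<forall>w\<in>words N. 0 \<le> \<nu> w) \<and> (\<Sum>w\<in>words N. \<nu> w) = 1 \<and>
    (\<forall>v\<in>words N. (\<Sum>w\<in>words N. \<nu> w * trans_matrix p q w v) = \<nu> v) \<and>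
    (\<forall>w. w \<notin> words N \<longrightarrow> \<nu> w = 0)"

definition inv_dist :: "nat \<Rightarrow> wvec \<Rightarrow> wvec \<Rightarrow> wvec"
  where "inv_dist N p q = (THE \<nu>. invariant_distribution N p q \<nu>)"

fun round_payoff :: "real \<Rightarrow> real \<Rightarrow> real \<Rightarrow> real \<Rightarrow> action \<Rightarrow> action \<Rightarrow> real"
  where
    "round_payoff a b c d C C = a + b"
  | "round_payoff a b c d C D = a + d"
  | "round_payoff a b c d D C = c + b"
  | "round_payoff a b c d D D = c + d"

text \<open>List positions start at 0, so \<open>i\<^sub>j\<close> is \<open>w ! (j - 1)\<close>.\<close>

definition payoff_vec :: "nat \<Rightarrow> real \<Rightarrow> real \<Rightarrow> real \<Rightarrow> real \<Rightarrow> wvec"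
  where "payoff_vec N a b c d w =
    (\<Sum>k = 1..N. round_payoff a b c d (w ! (2 * k - 2)) (w ! (2 * k - 1))) / real N"

definition payoff :: "nat \<Rightarrow> real \<Rightarrow> real \<Rightarrow> real \<Rightarrow> real \<Rightarrow> wvec \<Rightarrow> wvec \<Rightarrow> real"
  where "payoff N a b c d p q = (\<Sum>w\<in>words N. inv_dist N p q w * payoff_vec N a b c d w)"

definition partial_payoff ::
    "nat \<Rightarrow> real \<Rightarrow> real \<Rightarrow> real \<Rightarrow> real \<Rightarrow> wvec \<Rightarrow> wvec \<Rightarrow> action list \<Rightarrow> real"
  where "partial_payoff N a b c d p q w = deriv (\<lambda>x. payoff N a b c d (p(w := x)) q) (p w)"

text \<open>The time interval may be open, closed or half-open, bounded or not, but is not a single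
  point; at an endpoint belonging to it the derivative is one-sided.\<close>

definition trajectory ::
    "nat \<Rightarrow> real \<Rightarrow> real \<Rightarrow> real \<Rightarrow> real \<Rightarrow> real set \<Rightarrow> (real \<Rightarrow> wvec) \<Rightarrow> bool"
  where "trajectory N a b c d I p \<longleftrightarrow>
    is_interval I \<and> interior I \<noteq> {} \<and>
    (\<forall>t\<in>I. p t \<in> open_cube N \<and>
      (\<forall>w\<in>words N. ((\<lambda>s. p s w) has_real_derivative
         partial_payoff N a b c d (p t) (p t) w) (at t within I)))"

end

theory Submission
  imports Defs
begin

text \<open>
  Let \<open>p\<^sup>*\<close> be the strategy whose entry at a word is one minus the entry of \<open>p\<close> at the word with
  \<open>C\<close> and \<open>D\<close> interchanged. The interchange is an isomorphism between the Markov chains of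
  \<open>(p, q)\<close> and \<open>(p\<^sup>*, q\<^sup>*)\<close>. As \<open>R + P = S + T\<close>, it turns the payoff vector \<open>f\<close> into
  \<open>a + b + c + d - f\<close>, whence \<open>A(p\<^sup>*, q\<^sup>*) = a + b + c + d - A(p, q)\<close>. In the derivative of this
  identity the sign is compensated by the sign of the substitution \<open>x \<mapsto> 1 - x\<close>, so that the two
  gradients correspond to each other, and the sign in \<open>1 - p\<close> is compensated by reversing time.
\<close>

section \<open>Invariant distributions of finite stochastic matrices\<close>

definition stochastic_on :: "'a set \<Rightarrow> ('a \<Rightarrow> 'a \<Rightarrow> real) \<Rightarrow> bool"
  where "stochastic_on S M \<longleftrightarrow>
    (\<forall>i\<in>S. \<forall>j\<in>S. 0 \<le> M i j) \<and> (\<forall>i\<in>S. (\<Sum>j\<in>S. M i j) = 1)"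

text \<open>Irreducibility is put as the absence of proper closed sets instead of through powers or
  paths, since the closed set of interest is the support of a stationary vector.\<close>

definition irreducible_on :: "'a set \<Rightarrow> ('a \<Rightarrow> 'a \<Rightarrow> real) \<Rightarrow> bool"
  where "irreducible_on S M \<longleftrightarrow>
    (\<forall>T\<subseteq>S. T \<noteq> {} \<and> (\<forall>i\<in>T. \<forall>j\<in>S. M i j > 0 \<longrightarrow> j \<in> T) \<longrightarrow> T = S)"

text \<open>Neither sign nor mass is prescribed, so that the difference of two stationary
  distributions is covered.\<close>

definition stationary_on :: "'a set \<Rightarrow> ('a \<Rightarrow> 'a \<Rightarrow> real) \<Rightarrow> ('a \<Rightarrow> real) \<Rightarrow> bool"
  where "stationary_on S M \<nu> \<longleftrightarrow> (\<forall>j\<in>S. (\<Sum>i\<in>S. \<nu> i * M i j) = \<nu> j)"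

text \<open>A state \<open>s\<close> is eliminated by watching the chain only while it is outside \<open>s\<close>.\<close>

lemma stationary_nonzero_exists:
  assumes "finite S" "S \<noteq> {}" "stochastic_on S M"
  shows "\<exists>\<nu>. (\<forall>i\<in>S. 0 \<le> \<nu> i) \<and> (\<exists>i\<in>S. 0 < \<nu> i) \<and> stationary_on S M \<nu>"
  using assms
proof (induction S arbitrary: M rule: finite_ne_induct)
  case (singleton s)
  then show ?case
    by (intro exI[of _ "\<lambda>_. 1"]) (auto simp: stochastic_on_def stationary_on_def)
next
  case (insert s S)
  have nonneg: "0 \<le> M i j" if "i \<in> insert s S" "j \<in> insert s S" for i j
    using insert.prems that by (auto simp: stochastic_on_def)
  have row: "M i s + (\<Sum>j\<in>S. M i j) = 1" if "i \<in> insert s S" for i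
    using insert.prems insert.hyps that by (auto simp: stochastic_on_def)
  show ?case
  \<comment> \<open>An absorbing \<open>s\<close> cannot be eliminated, but then the point mass at
    \<open>s\<close> is stationary.\<close>
  proof (cases "M s s = 1")
    case True
    then have "(\<Sum>j\<in>S. M s j) = 0"
      using row[of s] by simp
    then have zero: "M s j = 0" if "j \<in> S" for j
      using that nonneg insert.hyps by (subst (asm) sum_nonneg_eq_0_iff) auto
    have "(\<Sum>i\<in>insert s S. (if i = s then 1 else 0) * M i j) = M s j" for j
      using insert.hyps by (simp add: sum.delta' if_distrib[of "\<lambda>x. x * _"] cong: if_cong)
    then have "stationary_on (insert s S) M (\<lambda>i. if i = s then 1 else 0)"
      using True zero unfolding stationary_on_def by auto
    then show ?thesis
      by (intro exI[of _ "\<lambda>i. if i = s then 1 else 0"]) auto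
  next
    case False
    have "0 \<le> (\<Sum>j\<in>S. M s j)"
      using nonneg by (intro sum_nonneg) auto
    then have less: "M s s < 1"
      using row[of s] False by simp
    \<comment> \<open>The second summand is the probability of a detour from \<open>i\<close> to
      \<open>j\<close> via \<open>s\<close>, summed over all durations of the stay by the geometric
      series \<open>1 / (1 - M s s)\<close>.\<close>
    define M' where "M' i j = M i j + M i s * M s j / (1 - M s s)" for i j
    have "stochastic_on S M'"
      unfolding stochastic_on_def
    proof (intro conjI ballI)
      show "0 \<le> M' i j" if "i \<in> S" "j \<in> S" for i j
        using that less nonneg by (auto simp: M'_def)
      show "(\<Sum>j\<in>S. M' i j) = 1" if "i \<in> S" for i
      proof -
        have "(\<Sum>j\<in>S. M' i j) = (\<Sum>j\<in>S. M i j) + M i s * (\<Sum>j\<in>S. M s j) / (1 - M s s)"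
          by (simp add: M'_def sum.distrib sum_distrib_left sum_divide_distrib)
        also have "(\<Sum>j\<in>S. M s j) = 1 - M s s"
          using row[of s] by simp
        finally show ?thesis
          using row[of i] that less by simp
      qed
    qed
    then obtain \<mu> where \<mu>: "\<And>i. i \<in> S \<Longrightarrow> 0 \<le> \<mu> i" "\<exists>i\<in>S. 0 < \<mu> i"
      and inv: "\<And>j. j \<in> S \<Longrightarrow> (\<Sum>i\<in>S. \<mu> i * M' i j) = \<mu> j"
      using insert.IH unfolding stationary_on_def by blast
    \<comment> \<open>The weight of \<open>s\<close> is forced: \<open>r\<close> solves the
      stationarity equation at \<open>s\<close>, namely
      \<open>r = r * M s s + (\<Sum>i\<in>S. \<mu> i * M i s)\<close>.\<close>
    define r where "r = (\<Sum>i\<in>S. \<mu> i * M i s) / (1 - M s s)"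
    have r: "0 \<le> r"
      unfolding r_def using \<mu>(1) nonneg less by (intro divide_nonneg_pos sum_nonneg) auto
    have split: "(\<Sum>i\<in>insert s S. (\<mu>(s := r)) i * M i j) = r * M s j + (\<Sum>i\<in>S. \<mu> i * M i j)" for j
      using insert.hyps by (auto intro!: sum.cong split: if_splits)
    have "stationary_on (insert s S) M (\<mu>(s := r))"
      unfolding stationary_on_def split
    proof
      fix j assume "j \<in> insert s S"
      show "r * M s j + (\<Sum>i\<in>S. \<mu> i * M i j) = (\<mu>(s := r)) j"
      proof (cases "j = s")
        case True
        have "(\<Sum>i\<in>S. \<mu> i * M i s) = r * (1 - M s s)"
          using less by (simp add: r_def)
        then show ?thesis
          using True by (simp add: algebra_simps)
      next
        case False
        then have "j \<in> S"
          using \<open>j \<in> insert s S\<close> by simp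
        have "(\<Sum>i\<in>S. \<mu> i * M' i j) = (\<Sum>i\<in>S. \<mu> i * M i j) + r * M s j"
          by (simp add: M'_def r_def algebra_simps sum.distrib sum_distrib_left sum_distrib_right
              sum_divide_distrib)
        then show ?thesis
          using inv[OF \<open>j \<in> S\<close>] False by simp
      qed
    qed
    moreover have "\<exists>i\<in>insert s S. 0 < (\<mu>(s := r)) i"
      using \<mu>(2) insert.hyps by auto
    moreover have "\<forall>i\<in>insert s S. 0 \<le> (\<mu>(s := r)) i"
      using \<mu>(1) r by simp
    ultimately show ?thesis
      by blast
  qed
qed

lemma stationary_distribution_exists:
  assumes "finite S" "S \<noteq> {}" "stochastic_on S M"
  shows "\<exists>\<nu>. (\<forall>i\<in>S. 0 \<le> \<nu> i) \<and> (\<Sum>i\<in>S. \<nu> i) = 1 \<and> stationary_on S M \<nu>"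
proof -
  obtain \<mu> where \<mu>: "\<forall>i\<in>S. 0 \<le> \<mu> i" "\<exists>i\<in>S. 0 < \<mu> i" "stationary_on S M \<mu>"
    using stationary_nonzero_exists[OF assms] by blast
  then have "0 < (\<Sum>i\<in>S. \<mu> i)"
    using assms(1) by (meson sum_pos2)
  moreover from this have "(\<Sum>i\<in>S. \<mu> i / (\<Sum>i\<in>S. \<mu> i)) = 1"
    by (simp flip: sum_divide_distrib)
  moreover have "stationary_on S M (\<lambda>i. \<mu> i / (\<Sum>i\<in>S. \<mu> i))"
    using \<mu>(3) by (simp add: stationary_on_def flip: sum_divide_distrib)
  ultimately show ?thesis
    using \<mu>(1) by (intro exI[of _ "\<lambda>i. \<mu> i / (\<Sum>i\<in>S. \<mu> i)"]) auto
qed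

text \<open>The positive part is subinvariant, and a stochastic matrix preserves the total mass.\<close>

lemma stationary_positive_part:
  assumes "finite S" "stochastic_on S M" "stationary_on S M \<delta>"
  shows "stationary_on S M (\<lambda>i. max 0 (\<delta> i))"
proof -
  let ?m = "\<lambda>j. \<Sum>i\<in>S. max 0 (\<delta> i) * M i j"
  have nonneg: "0 \<le> M i j" if "i \<in> S" "j \<in> S" for i j
    using assms(2) that by (auto simp: stochastic_on_def)
  have ge: "max 0 (\<delta> j) \<le> ?m j" if "j \<in> S" for j
  proof -
    have "\<delta> j = (\<Sum>i\<in>S. \<delta> i * M i j)"
      using assms(3) that by (simp add: stationary_on_def)
    also have "\<dots> \<le> ?m j"
      using that nonneg by (intro sum_mono mult_right_mono) auto
    finally have "\<delta> j \<le> ?m j" .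
    moreover have "0 \<le> ?m j"
      using that nonneg by (intro sum_nonneg) auto
    ultimately show ?thesis by simp
  qed
  have "(\<Sum>j\<in>S. ?m j) = (\<Sum>i\<in>S. \<Sum>j\<in>S. max 0 (\<delta> i) * M i j)"
    by (rule sum.swap)
  also have "\<dots> = (\<Sum>i\<in>S. max 0 (\<delta> i))"
    using assms(2) by (intro sum.cong) (auto simp: stochastic_on_def simp flip: sum_distrib_left)
  finally have "(\<Sum>j\<in>S. ?m j - max 0 (\<delta> j)) = 0"
    by (simp add: sum_subtractf)
  then have "\<forall>j\<in>S. ?m j - max 0 (\<delta> j) = 0"
    using assms(1) ge by (subst (asm) sum_nonneg_eq_0_iff) auto
  then show ?thesis
    by (simp add: stationary_on_def)
qed

text \<open>The support of a nonnegative stationary vector is closed under transitions of positive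
  probability, so by irreducibility it is empty or everything.\<close>

lemma stationary_nonneg_imp_pos:
  assumes "finite S" "stochastic_on S M" "irreducible_on S M" "stationary_on S M \<mu>"
    and "\<And>i. i \<in> S \<Longrightarrow> 0 \<le> \<mu> i" "k \<in> S" "0 < \<mu> k" "l \<in> S"
  shows "0 < \<mu> l"
proof -
  let ?T = "{i\<in>S. 0 < \<mu> i}"
  have "0 < \<mu> j" if "i \<in> ?T" "j \<in> S" "0 < M i j" for i j
  proof -
    have "0 < (\<Sum>i\<in>S. \<mu> i * M i j)"
      using assms(1,2,5) that by (intro sum_pos2[of S i]) (auto simp: stochastic_on_def)
    then show ?thesis
      using assms(4) that by (simp add: stationary_on_def)
  qed
  then have "\<forall>i\<in>?T. \<forall>j\<in>S. M i j > 0 \<longrightarrow> j \<in> ?T"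
    by simp
  moreover have "?T \<noteq> {}"
    using assms(6,7) by blast
  ultimately have "?T = S"
    using assms(3)[unfolded irreducible_on_def, rule_format, of ?T] by simp
  then show ?thesis
    using assms(8) by blast
qed

text \<open>If the difference were positive somewhere, its positive part, being stationary, would be
  positive everywhere; but the difference has total mass zero.\<close>

lemma stationary_distribution_unique:
  assumes fin: "finite S" and sto: "stochastic_on S M" and irr: "irreducible_on S M"
    and "stationary_on S M \<mu>" "stationary_on S M \<nu>"
    and mass: "(\<Sum>i\<in>S. \<mu> i) = (\<Sum>i\<in>S. \<nu> i)" and "i \<in> S"
  shows "\<mu> i = \<nu> i"
proof -
  have no_sign: "\<alpha> j \<le> \<beta> j"
    if "stationary_on S M \<alpha>" "stationary_on S M \<beta>" "(\<Sum>i\<in>S. \<alpha> i) = (\<Sum>i\<in>S. \<beta> i)" "j \<in> S"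
    for \<alpha> \<beta> :: "'a \<Rightarrow> real" and j
  proof (rule ccontr)
    assume "\<not> \<alpha> j \<le> \<beta> j"
    define \<delta> where "\<delta> i = \<alpha> i - \<beta> i" for i
    have "stationary_on S M \<delta>"
      using that(1,2) by (simp add: stationary_on_def \<delta>_def left_diff_distrib sum_subtractf)
    then have "stationary_on S M (\<lambda>i. max 0 (\<delta> i))"
      using stationary_positive_part[OF fin sto] by blast
    then have "0 < max 0 (\<delta> l)" if "l \<in> S" for l
      using stationary_nonneg_imp_pos[OF fin sto irr, of "\<lambda>i. max 0 (\<delta> i)" j l]
        \<open>j \<in> S\<close> \<open>\<not> \<alpha> j \<le> \<beta> j\<close> that by (simp add: \<delta>_def)
    then have "0 < (\<Sum>i\<in>S. \<delta> i)"
      using fin \<open>j \<in> S\<close> by (intro sum_pos) (auto simp: less_max_iff_disj)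
    then show False
      using that(3) by (simp add: \<delta>_def sum_subtractf)
  qed
  show ?thesis
    using no_sign[of \<mu> \<nu> i] no_sign[of \<nu> \<mu> i] assms by simp
qed

section \<open>The memory-N chain\<close>

lemma shift_in_words:
  assumes "N \<ge> 1" "w \<in> words N"
  shows "drop 2 w @ [x, y] \<in> words N" "tl w @ [x] \<in> words N"
  using assms by (auto simp: words_def)

lemma sum_trans_matrix:
  assumes "N \<ge> 1" "w \<in> words N"
  shows "(\<Sum>v\<in>words N. trans_matrix p q w v) = 1"
proof -
  let ?T = "{drop 2 w @ [C, C], drop 2 w @ [C, D], drop 2 w @ [D, C], drop 2 w @ [D, D]}"
  have "(\<Sum>v\<in>words N. trans_matrix p q w v) = (\<Sum>v\<in>?T. trans_matrix p q w v)"
    using assms by (intro sum.mono_neutral_right)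
      (auto simp: shift_in_words trans_matrix_def)
  also have "\<dots> = 1"
    by (simp add: trans_matrix_def algebra_simps)
  finally show ?thesis .
qed

lemma trans_matrix_nonneg:
  assumes "N \<ge> 1" "p \<in> open_cube N" "q \<in> open_cube N" "w \<in> words N"
  shows "0 \<le> trans_matrix p q w v"
  using assms shift_in_words[OF assms(1,4)]
  by (simp add: trans_matrix_def open_cube_def less_imp_le)

lemma trans_matrix_pos:
  assumes "N \<ge> 1" "p \<in> open_cube N" "q \<in> open_cube N" "w \<in> words N"
  shows "0 < trans_matrix p q w (drop 2 w @ [x, y])"
  using assms shift_in_words[OF assms(1,4)]
  by (cases x; cases y) (simp_all add: trans_matrix_def open_cube_def)

lemma stochastic_trans_matrix:
  assumes "N \<ge> 1" "p \<in> open_cube N" "q \<in> open_cube N"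
  shows "stochastic_on (words N) (trans_matrix p q)"
  using assms sum_trans_matrix trans_matrix_nonneg by (auto simp: stochastic_on_def)

text \<open>On the open cube every pair of moves has positive probability, so any word can be
  written into the memory in \<open>N\<close> rounds.\<close>

lemma irreducible_trans_matrix:
  assumes "N \<ge> 1" "p \<in> open_cube N" "q \<in> open_cube N"
  shows "irreducible_on (words N) (trans_matrix p q)"
  unfolding irreducible_on_def
proof (intro allI impI, elim conjE)
  fix T assume T: "T \<subseteq> words N" "T \<noteq> {}"
    and closed: "\<forall>i\<in>T. \<forall>j\<in>words N. trans_matrix p q i j > 0 \<longrightarrow> j \<in> T"
  have step: "drop 2 u @ [x, y] \<in> T" if "u \<in> T" for u x y
    using that T closed assms by (meson subsetD shift_in_words(1) trans_matrix_pos)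
  obtain w where w: "w \<in> T" using T by blast
  have "v \<in> T" if "v \<in> words N" for v
  proof -
    have len: "length w = 2 * N" "length v = 2 * N"
      using w T that by (auto simp: words_def)
    \<comment> \<open>The memory after \<open>k\<close> rounds in which the letters of
      \<open>v\<close> have been played in pairs.\<close>
    have "drop (2 * k) w @ take (2 * k) v \<in> T" if "k \<le> N" for k
      using that
    proof (induction k)
      case 0
      then show ?case using w by simp
    next
      case (Suc k)
      have "drop (2 * Suc k) w @ take (2 * Suc k) v =
          drop 2 (drop (2 * k) w @ take (2 * k) v) @ [v ! (2 * k), v ! (2 * k + 1)]"
        using Suc.prems len by (simp add: take_Suc_conv_app_nth)
      moreover have "drop (2 * k) w @ take (2 * k) v \<in> T"
        using Suc by simp
      ultimately show ?case
        using step by metis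
    qed
    from this[of N] show ?thesis
      using len by simp
  qed
  then show "T = words N" using T by blast
qed

text \<open>This makes the description operator in \<open>inv_dist\<close> meaningful. Values off
  \<open>words N\<close> are set to zero, as the definition demands.\<close>

lemma invariant_distribution_ex1:
  assumes "N \<ge> 1" "p \<in> open_cube N" "q \<in> open_cube N"
  shows "\<exists>!\<nu>. invariant_distribution N p q \<nu>"
proof (rule ex_ex1I)
  note sto = stochastic_trans_matrix[OF assms]
  have "replicate (2 * N) C \<in> words N"
    by (simp add: words_def)
  then obtain \<nu> where \<nu>: "\<forall>i\<in>words N. 0 \<le> \<nu> i" "(\<Sum>i\<in>words N. \<nu> i) = 1"
      "stationary_on (words N) (trans_matrix p q) \<nu>"
    using stationary_distribution_exists[OF finite_words _ sto] by blast
  have "invariant_distribution N p q (\<lambda>w. if w \<in> words N then \<nu> w else 0)"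
    using \<nu> by (simp add: invariant_distribution_def stationary_on_def)
  then show "\<exists>\<nu>. invariant_distribution N p q \<nu>"
    by blast
  fix \<mu> \<nu>
  assume inv: "invariant_distribution N p q \<mu>" "invariant_distribution N p q \<nu>"
  show "\<mu> = \<nu>"
  proof
    fix w
    show "\<mu> w = \<nu> w"
    proof (cases "w \<in> words N")
      case True
      show ?thesis
        by (rule stationary_distribution_unique[OF finite_words sto irreducible_trans_matrix[OF assms]
              _ _ _ True])
          (use inv in \<open>auto simp: invariant_distribution_def stationary_on_def\<close>)
    next
      case False
      then show ?thesis
        using inv by (simp add: invariant_distribution_def)
    qed
  qed
qed

lemma invariant_distribution_inv_dist:
  assumes "N \<ge> 1" "p \<in> open_cube N" "q \<in> open_cube N"
  shows "invariant_distribution N p q (inv_dist N p q)"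
  unfolding inv_dist_def using invariant_distribution_ex1[OF assms] by (rule theI')

section \<open>Interchanging C and D\<close>

fun flip :: "action \<Rightarrow> action"
  where "flip C = D" | "flip D = C"

lemma flip_flip [simp]: "flip (flip x) = x"
  by (cases x) simp_all

lemma flip_comp_flip [simp]: "flip \<circ> flip = id"
  by (simp add: fun_eq_iff)

lemma map_flip_flip: "map flip (map flip w) = w"
  by simp

lemma map_flip_eq_iff: "map flip v = w \<longleftrightarrow> v = map flip w"
  by (metis map_flip_flip)

lemma map_flip_in_words_iff [simp]: "map flip w \<in> words N \<longleftrightarrow> w \<in> words N"
  by (simp add: words_def)

lemma map_flip_bij_words: "bij_betw (map flip) (words N) (words N)"
  by (rule bij_betw_byWitness[where f' = "map flip"]) (auto simp: map_flip_eq_iff)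

text \<open>Equal lengths exclude proper prefixes, which would remain smaller after the
  interchange.\<close>

lemma map_flip_antimono:
  "length v = length w \<Longrightarrow> map flip v \<le> map flip w \<longleftrightarrow> w \<le> v"
proof (induction v w rule: list_induct2)
  case (Cons x v y w)
  then show ?case
    by (cases x; cases y) (auto simp: less_action_def)
qed simp

text \<open>The interchange permutes the words and reverses their order, and a finite set has only
  one strictly increasing enumeration.\<close>

lemma rev_lex_words: "rev (lex_words N) = map (map flip) (lex_words N)"
proof -
  have set: "set (lex_words N) = words N"
    by (simp add: lex_words_def)
  have "sorted (rev (map (map flip) (lex_words N)))"
  proof -
    have "sorted_wrt (\<lambda>v w. v \<le> w) (lex_words N)"
      by (simp add: lex_words_def)
    then have "sorted_wrt (\<lambda>v w. map flip w \<le> map flip v) (lex_words N)"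
      by (rule sorted_wrt_mono_rel[rotated]) (simp add: set map_flip_antimono words_def)
    then show ?thesis
      by (simp add: sorted_wrt_rev sorted_wrt_map)
  qed
  moreover have "distinct (rev (map (map flip) (lex_words N)))"
    using map_flip_bij_words[of N]
    by (simp add: distinct_map bij_betw_def set lex_words_def)
  moreover have "set (rev (map (map flip) (lex_words N))) = set (lex_words N)"
    using map_flip_bij_words[of N] by (simp add: set bij_betw_def)
  ultimately have "rev (map (map flip) (lex_words N)) = lex_words N"
    by (intro sorted_distinct_set_unique) (simp_all add: lex_words_def)
  then show ?thesis
    by (metis rev_rev_ident)
qed

lemma of_entries_map:
  assumes "w \<in> words N"
  shows "of_entries N (map f (lex_words N)) w = f w"
  using assms by (simp add: of_entries_def map_of_zip_map lex_words_def)

text \<open>Links the reversed list of the theorem to the letterwise interchange, with which all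
  further arguments work.\<close>

lemma of_entries_rev_entries:
  assumes "w \<in> words N"
  shows "of_entries N (map f (rev (entries N p))) w = f (p (map flip w))"
proof -
  have "map f (rev (entries N p)) = map (\<lambda>w. f (p (map flip w))) (lex_words N)"
    by (simp add: entries_def rev_map rev_lex_words comp_def)
  then show ?thesis
    using of_entries_map[OF assms] by simp
qed

section \<open>Dual strategies, their invariant distributions and payoffs\<close>

text \<open>Off \<^term>\<open>words N\<close> a strategy is unspecified, hence a relation instead of a map.\<close>

definition dual_strategy :: "nat \<Rightarrow> wvec \<Rightarrow> wvec \<Rightarrow> bool"
  where "dual_strategy N p p' \<longleftrightarrow> (\<forall>w\<in>words N. p' w = 1 - p (map flip w))"

lemma dual_strategy_open_cube:
  assumes "dual_strategy N p p'" "p \<in> open_cube N"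
  shows "p' \<in> open_cube N"
  using assms by (simp add: dual_strategy_def open_cube_def)

text \<open>Moving one coordinate of the dual strategy moves the interchanged coordinate of the
  original in the opposite direction; needed for partial derivatives.\<close>

lemma dual_strategy_update:
  assumes "dual_strategy N p p'"
  shows "dual_strategy N (p(map flip w := 1 - x)) (p'(w := x))"
  using assms by (auto simp: dual_strategy_def map_flip_eq_iff)

text \<open>The interchange swaps the successors ending in \<open>CC\<close> and \<open>DD\<close>,
  and those ending in \<open>CD\<close> and \<open>DC\<close>, while duality swaps the probabilities
  of \<open>C\<close> and \<open>D\<close>.\<close>

lemma trans_matrix_dual:
  assumes "N \<ge> 1" "dual_strategy N p p'" "dual_strategy N q q'" "w \<in> words N"
  shows "trans_matrix p' q' w v = trans_matrix p q (map flip w) (map flip v)"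
  using assms shift_in_words[OF assms(1,4)]
  by (auto simp: trans_matrix_def dual_strategy_def map_flip_eq_iff drop_map map_tl)

lemma sum_words_flip: "(\<Sum>w\<in>words N. f (map flip w)) = (\<Sum>w\<in>words N. f w)"
  by (rule sum.reindex_bij_betw[OF map_flip_bij_words])

lemma invariant_distribution_dual:
  assumes "N \<ge> 1" "dual_strategy N p p'" "dual_strategy N q q'"
    and "invariant_distribution N p q \<nu>"
  shows "invariant_distribution N p' q' (\<lambda>w. \<nu> (map flip w))"
proof -
  have "(\<Sum>w\<in>words N. \<nu> (map flip w) * trans_matrix p' q' w v) = \<nu> (map flip v)"
    if "v \<in> words N" for v
  proof -
    have "(\<Sum>w\<in>words N. \<nu> (map flip w) * trans_matrix p' q' w v) =
        (\<Sum>w\<in>words N. \<nu> (map flip w) * trans_matrix p q (map flip w) (map flip v))"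
      using trans_matrix_dual[OF assms(1-3)] by simp
    also have "\<dots> = (\<Sum>w\<in>words N. \<nu> w * trans_matrix p q w (map flip v))"
      by (rule sum_words_flip)
    finally show ?thesis
      using assms(4) that by (simp add: invariant_distribution_def)
  qed
  then show ?thesis
    using assms(4) by (simp add: invariant_distribution_def sum_words_flip)
qed

lemma payoff_vec_flip:
  assumes "N \<ge> 1" "w \<in> words N"
  shows "payoff_vec N a b c d (map flip w) = a + b + c + d - payoff_vec N a b c d w"
proof -
  have flip: "round_payoff a b c d (flip x) (flip y) = a + b + c + d - round_payoff a b c d x y"
    for x y
    by (cases x; cases y) simp_all
  have "(\<Sum>k = 1..N. round_payoff a b c d (map flip w ! (2 * k - 2)) (map flip w ! (2 * k - 1)))
      = (\<Sum>k = 1..N. a + b + c + d - round_payoff a b c d (w ! (2 * k - 2)) (w ! (2 * k - 1)))"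
    using assms(2) by (intro sum.cong) (auto simp: words_def flip)
  then show ?thesis
    using assms(1) by (simp add: payoff_vec_def sum_subtractf diff_divide_distrib)
qed

lemma payoff_dual:
  assumes "N \<ge> 1" "dual_strategy N p p'" "dual_strategy N q q'"
    and "p \<in> open_cube N" "q \<in> open_cube N"
  shows "payoff N a b c d p' q' = a + b + c + d - payoff N a b c d p q"
proof -
  let ?f = "payoff_vec N a b c d"
  note inv = invariant_distribution_inv_dist[OF assms(1,4,5)]
  note cube = dual_strategy_open_cube[OF assms(2,4)] dual_strategy_open_cube[OF assms(3,5)]
  \<comment> \<open>The flipped distribution is invariant for the dual pair, hence is the one chosen
    by uniqueness.\<close>
  have "inv_dist N p' q' = (\<lambda>w. inv_dist N p q (map flip w))"
    unfolding inv_dist_def[of N p' q']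
    using invariant_distribution_ex1[OF assms(1) cube] invariant_distribution_dual[OF assms(1-3) inv]
    by (metis (mono_tags, lifting) theI_unique)
  then have "payoff N a b c d p' q' = (\<Sum>w\<in>words N. inv_dist N p q (map flip w) * ?f w)"
    by (simp add: payoff_def)
  also have "\<dots> = (\<Sum>w\<in>words N. inv_dist N p q w * ?f (map flip w))"
    using sum_words_flip[of "\<lambda>w. inv_dist N p q w * ?f (map flip w)" N] by (simp add: comp_def)
  also have "\<dots> = (\<Sum>w\<in>words N. inv_dist N p q w * (a + b + c + d) - inv_dist N p q w * ?f w)"
    using assms(1) by (intro sum.cong) (simp_all add: payoff_vec_flip right_diff_distrib)
  also have "\<dots> = (\<Sum>w\<in>words N. inv_dist N p q w) * (a + b + c + d) - payoff N a b c d p q"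
    unfolding payoff_def sum_subtractf sum_distrib_right ..
  finally show ?thesis
    using inv by (simp add: invariant_distribution_def)
qed

section \<open>Gradients and trajectories under the interchange\<close>

text \<open>Holds also where \<open>g\<close> is not differentiable and both sides are junk values.\<close>

lemma deriv_point_reflection:
  fixes g :: "real \<Rightarrow> real"
  shows "deriv (\<lambda>x. K - g (1 - x)) x = deriv g (1 - x)"
proof -
  have reflect: "((\<lambda>x. K - g (1 - x)) has_real_derivative D) (at x)"
    if "(g has_real_derivative D) (at (1 - x))" for g :: "real \<Rightarrow> real" and x D
  proof -
    have "((\<lambda>x. g (1 - x)) has_real_derivative D * (0 - 1)) (at x)"
      using that by (intro DERIV_chain2[where f = g]) (auto intro!: derivative_eq_intros)
    then show ?thesis
      by (auto intro!: derivative_eq_intros)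
  qed
  \<comment> \<open>The reflection is an involution, so one implication yields both. As the same
    \<open>D\<close> qualify on both sides, \<open>deriv\<close> chooses the same value.\<close>
  have "((\<lambda>x. K - g (1 - x)) has_real_derivative D) (at x) \<longleftrightarrow>
      (g has_real_derivative D) (at (1 - x))" for D
    using reflect[of g D x] reflect[of "\<lambda>x. K - g (1 - x)" D "1 - x"] by auto
  then show ?thesis
    by (simp add: deriv_def)
qed

lemma open_cube_update:
  assumes "p \<in> open_cube N" "0 < x" "x < 1"
  shows "p(w := x) \<in> open_cube N"
  using assms by (simp add: open_cube_def)

lemma partial_payoff_dual:
  assumes "N \<ge> 1" "dual_strategy N p p'" "dual_strategy N q q'"
    and "p \<in> open_cube N" "q \<in> open_cube N" "w \<in> words N"
  shows "partial_payoff N a b c d p' q' w = partial_payoff N a b c d p q (map flip w)"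
proof -
  have p': "p' w = 1 - p (map flip w)" "0 < p' w" "p' w < 1"
    using assms by (simp_all add: dual_strategy_def open_cube_def)
  \<comment> \<open>The payoff identity is known only for strategies in the cube; since
    \<open>deriv\<close> is local, it suffices to keep the varied entry in
    \<open>(0,1)\<close>.\<close>
  then have "eventually (\<lambda>x. x \<in> {0<..<1}) (nhds (p' w))"
    by (intro eventually_nhds_in_open) auto
  then have "eventually (\<lambda>x. payoff N a b c d (p'(w := x)) q' =
      a + b + c + d - payoff N a b c d (p(map flip w := 1 - x)) q) (nhds (p' w))"
    by eventually_elim
      (auto intro!: payoff_dual dual_strategy_update open_cube_update assms)
  then have "partial_payoff N a b c d p' q' w =
      deriv (\<lambda>x. a + b + c + d - payoff N a b c d (p(map flip w := 1 - x)) q) (p' w)"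
    unfolding partial_payoff_def by (rule deriv_cong_ev) simp
  then show ?thesis
    using p' deriv_point_reflection[of _ "\<lambda>x. payoff N a b c d (p(map flip w := x)) q"]
    by (simp add: partial_payoff_def)
qed

theorem theorem2p13:
  fixes N :: nat and a b c d :: real and I :: "real set"
    and p :: "real \<Rightarrow> action list \<Rightarrow> real"
  assumes "N \<ge> 1"
    and "c > a" and "c - a < b - d"
    and "trajectory N a b c d I p"
  shows "trajectory N a b c d (uminus ` I)
    (\<lambda>t. of_entries N (map (\<lambda>x. 1 - x) (rev (entries N (p (- t))))))"
proof -
  define p' where "p' t = of_entries N (map (\<lambda>x. 1 - x) (rev (entries N (p (- t)))))" for t
  have p': "p' t w = 1 - p (- t) (map flip w)" if "w \<in> words N" for t w
    using that by (simp add: p'_def of_entries_rev_entries)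
  then have dual: "dual_strategy N (p (- t)) (p' t)" for t
    by (simp add: dual_strategy_def)
  have "is_interval (uminus ` I)"
    using assms(4) by (simp add: trajectory_def)
  moreover have "interior (uminus ` I) \<noteq> {}"
    using assms(4) by (simp add: trajectory_def interior_negations)
  moreover have "p' t \<in> open_cube N \<and> (\<forall>w\<in>words N. ((\<lambda>s. p' s w) has_real_derivative
      partial_payoff N a b c d (p' t) (p' t) w) (at t within uminus ` I))"
    if "t \<in> uminus ` I" for t
  proof (intro conjI ballI)
    have t: "- t \<in> I"
      using that by auto
    then have cube: "p (- t) \<in> open_cube N"
      using assms(4) by (simp add: trajectory_def)
    then show "p' t \<in> open_cube N"
      using dual dual_strategy_open_cube by blast
    fix w assume w: "w \<in> words N"
    let ?D = "partial_payoff N a b c d (p (- t)) (p (- t)) (map flip w)"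
    \<comment> \<open>\<open>I\<close> is presented as the negation of \<open>-I\<close> to fit the
      chain rule within sets, which also covers one-sided derivatives at endpoints.\<close>
    have "((\<lambda>s. p s (map flip w)) has_real_derivative ?D) (at (- t) within uminus ` uminus ` I)"
      using assms(4) t w by (simp add: trajectory_def image_image)
    then have "((\<lambda>s. p s (map flip w)) \<circ> uminus has_real_derivative ?D * - 1)
        (at t within uminus ` I)"
      by (rule DERIV_image_chain) (auto intro!: derivative_eq_intros)
    then have "((\<lambda>s. 1 - p (- s) (map flip w)) has_real_derivative ?D) (at t within uminus ` I)"
      by (auto intro!: derivative_eq_intros simp: comp_def)
    then show "((\<lambda>s. p' s w) has_real_derivative partial_payoff N a b c d (p' t) (p' t) w)
        (at t within uminus ` I)"
      using w p' partial_payoff_dual[OF assms(1) dual dual cube cube w] by simp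
  qed
  ultimately show ?thesis
    unfolding trajectory_def p'_def by blast
qed

end
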